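(* Let $T$ be a nonnegative $n \times n$ matrix. The following assertions are equivalent. (i) There exist nonnegative $n\times n$ matrices $M$ and $N$ such that $T = MN$ and $M^2 = N^2 = NM = 0$. (ii) There exists a nonnegative $n\times n$ matrix $U$ such that $T = U^2$ and $U^3 = 0$. (iii) There exists a decomposition $\mathbb{R}^n = L_1\oplus L_2\oplus L_3$ into standard subspaces with respect to which the operator $T$ is of the form $$T=\begin{pmatrix} 0 & 0 & T_{13}\\ 0 & 0 & 0\\ 0 & 0 & 0\end{pmatrix}$$ for some positive operator $T_{13}\colon L_3\to L_1$ with $\operatorname{rank}^+(T_{13}) \le \dim(L_2)$.
   Context: A matrix is nonnegative if all its entries are (real and) nonnegative. A standard subspace of $\mathbb{R}^n$ is the linear span of some (possibly empty) set of standard unit vectors; in a decomposition $\mathbb{R}^n=L_1\oplus L_2\oplus L_3$ into standard subspaces, the $L_i$ are thus spanned by disjoint sets of standard unit vectors that together give all of them, and some $L_i$ may be $\{0\}$. A linear operator between such subspaces is positive if it maps vectors with nonnegative coordinates to vectors with nonnegative coordinates, i.e. its matrix in the standard unit vectors is nonnegative. The nonnegative rank $\operatorname{rank}^+(A)$ of a nonnegative $m\times n$ matrix $A$ is the smallest integer $k\ge 0$ for which there exist a nonnegative $m\times k$ matrix $L$ and a nonnegative $k\times n$ matrix $R$ with $A=LR$ (the operator $T_{13}$ is identified with its matrix in the standard unit vectors). *)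

theory Defs
  imports
    "Jordan_Normal_Form.VS_Connect"
    "Jordan_Normal_Form.DL_Missing_Sublist"
begin

definition nonneg_mat :: "real mat \<Rightarrow> bool" where
  "nonneg_mat A \<longleftrightarrow> (\<forall>i < dim_row A. \<forall>j < dim_col A. 0 \<le> A $$ (i, j))"

definition nonneg_vec :: "real vec \<Rightarrow> bool" where
  "nonneg_vec v \<longleftrightarrow> (\<forall>i < dim_vec v. 0 \<le> v $ i)"

text \<open>
  Meaningful for nonnegative \<open>A\<close> only: then \<open>A = 1 * A\<close> is an admissible factorization, so the
  least \<open>k\<close> is attained. For \<open>k = 0\<close> the product \<open>L * R\<close> is the zero matrix.
\<close>
definition nonneg_rank :: "real mat \<Rightarrow> nat" where
  "nonneg_rank A = (LEAST k. \<exists>L R. L \<in> carrier_mat (dim_row A) k \<and> R \<in> carrier_mat k (dim_col A) \<and>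
     nonneg_mat L \<and> nonneg_mat R \<and> A = L * R)"

definition standard_subspace :: "nat \<Rightarrow> real vec set \<Rightarrow> bool" where
  "standard_subspace n L \<longleftrightarrow>
     (\<exists>I \<subseteq> {..<n}. L = LinearCombinations.module.span class_ring (module_vec TYPE(real) n) (unit_vec n ` I))"

text \<open>The subspace \<open>L\<close> of \<open>\<real>\<^sup>n\<close> as a vector space in its own right.\<close>
abbreviation subspace_vs :: "nat \<Rightarrow> real vec set \<Rightarrow> (real, real vec) module" where
  "subspace_vs n L \<equiv> module_vec TYPE(real) n\<lparr>carrier := L\<rparr>"

text \<open>
  Internal direct sum: every vector of \<open>\<real>\<^sup>n\<close> is uniquely a sum \<open>v1 + v2 + v3\<close> with \<open>vi\<close> in \<open>Li\<close>.
\<close>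
definition standard_decomposition ::
  "nat \<Rightarrow> real vec set \<Rightarrow> real vec set \<Rightarrow> real vec set \<Rightarrow> bool" where
  "standard_decomposition n L1 L2 L3 \<longleftrightarrow>
     standard_subspace n L1 \<and> standard_subspace n L2 \<and> standard_subspace n L3 \<and>
     bij_betw (\<lambda>(v1, v2, v3). v1 + v2 + v3) (L1 \<times> L2 \<times> L3) (carrier_vec n)"

text \<open>
  Operators between subspaces of \<open>\<real>\<^sup>n\<close> are total functions of which only the values on
  the source \<open>V\<close> matter.
\<close>
definition positive_operator ::
  "nat \<Rightarrow> real vec set \<Rightarrow> real vec set \<Rightarrow> (real vec \<Rightarrow> real vec) \<Rightarrow> bool" where
  "positive_operator n V W f \<longleftrightarrow>
     linear_map class_ring (subspace_vs n V) (subspace_vs n W) f \<and>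
     (\<forall>v \<in> V. nonneg_vec v \<longrightarrow> nonneg_vec (f v))"

definition unit_indices :: "nat \<Rightarrow> real vec set \<Rightarrow> nat set" where
  "unit_indices n L = {i. i < n \<and> unit_vec n i \<in> L}"

text \<open>
  The matrix of \<open>f : V \<rightarrow> W\<close> with respect to the standard unit vectors lying in \<open>V\<close> and in \<open>W\<close>,
  both in increasing order of index (\<open>pick I k\<close> is the \<open>k\<close>-th smallest element of \<open>I\<close>,
  counting from 0).
\<close>
definition operator_matrix ::
  "nat \<Rightarrow> real vec set \<Rightarrow> real vec set \<Rightarrow> (real vec \<Rightarrow> real vec) \<Rightarrow> real mat" where
  "operator_matrix n V W f =
     mat (card (unit_indices n W)) (card (unit_indices n V))
       (\<lambda>(i, j). f (unit_vec n (pick (unit_indices n V) j)) $ pick (unit_indices n W) i)"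

text \<open>
  \<open>T\<close> has the block form with the single possibly nonzero block \<open>f : L3 \<rightarrow> L1\<close> in the upper
  right corner: it sends \<open>v1 + v2 + v3\<close> to the vector with components \<open>f v3\<close>, \<open>0\<close>, \<open>0\<close>.
\<close>
definition corner_block_form ::
  "real mat \<Rightarrow> real vec set \<Rightarrow> real vec set \<Rightarrow> real vec set \<Rightarrow> (real vec \<Rightarrow> real vec) \<Rightarrow> bool" where
  "corner_block_form T L1 L2 L3 f \<longleftrightarrow>
     (\<forall>v1 \<in> L1. \<forall>v2 \<in> L2. \<forall>v3 \<in> L3. f v3 \<in> L1 \<and> T *\<^sub>v (v1 + v2 + v3) = f v3)"

end

theory Submission
  imports Defs "Jordan_Normal_Form.DL_Rank"
begin

text \<open>
  Everything reduces to one combinatorial condition: \<open>{..<n}\<close> splits into index sets \<open>I1\<close>, \<open>I2\<close>, \<open>I3\<close>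
  such that \<open>T\<close> is supported on \<open>I1 \<times> I3\<close> and factors there through \<open>I2\<close> with nonnegative factors.
  Given such data, \<open>M\<close> is supported on \<open>I1 \<times> I2\<close> and \<open>N\<close> on \<open>I2 \<times> I3\<close>; given \<open>M\<close> and \<open>N\<close>, put
  \<open>U = M + N\<close>. Given \<open>U\<close>, nonnegativity excludes cancellation, so \<open>U\<^sup>3 = 0\<close> means that the digraph of \<open>U\<close>
  has no walk of length three. Let \<open>I1\<close> be the indices from which a walk of length two
  starts, \<open>I3\<close> those at which one ends, and \<open>I2\<close> the rest: the sets \<open>I1\<close> and \<open>I3\<close> are disjoint, and
  the middle vertex of a walk of length two lies in neither.
\<close>

section \<open>Coordinate subspaces\<close>

text \<open>Describing the span of the unit vectors with index in \<open>I\<close> by vanishing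
  coordinates lets membership be decided entry by entry;
  \<open>span_unit_vecs_eq_coord_subspace\<close> justifies the replacement.\<close>

definition coord_subspace :: "nat \<Rightarrow> nat set \<Rightarrow> real vec set" where
  "coord_subspace n I = {v \<in> carrier_vec n. \<forall>i<n. i \<notin> I \<longrightarrow> v $ i = 0}"

lemma zero_in_coord_subspace [simp]: "0\<^sub>v n \<in> coord_subspace n I"
  by (simp add: coord_subspace_def)

lemma coord_subspace_carrier: "v \<in> coord_subspace n I \<Longrightarrow> v \<in> carrier_vec n"
  by (simp add: coord_subspace_def)

lemma unit_vec_in_coord_subspace: "i < n \<Longrightarrow> unit_vec n i \<in> coord_subspace n I \<longleftrightarrow> i \<in> I"
  by (auto simp: coord_subspace_def)

lemma unit_indices_coord_subspace: "I \<subseteq> {..<n} \<Longrightarrow> unit_indices n (coord_subspace n I) = I"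
  by (auto simp: unit_indices_def unit_vec_in_coord_subspace)

lemma inj_on_unit_vec: "inj_on (unit_vec n :: nat \<Rightarrow> real vec) {..<n}"
  by (rule inj_onI) (auto simp: unit_vec_eq)

lemma submodule_coord_subspace:
  "submodule class_ring (coord_subspace n I) (module_vec TYPE(real) n)"
proof -
  interpret vec_space "TYPE(real)" n .
  show ?thesis
    by unfold_locales (auto simp: coord_subspace_def module_vec_simps)
qed

text \<open>One inclusion holds because the right side is a submodule containing the generators. For
  the other, a vector supported on \<open>I\<close> is the combination of the generators with its
  own coordinates as coefficients.\<close>

lemma span_unit_vecs_eq_coord_subspace:
  assumes "I \<subseteq> {..<n}"
  shows "LinearCombinations.module.span class_ring (module_vec TYPE(real) n) (unit_vec n ` I)
    = coord_subspace n I"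
proof -
  interpret vec_space "TYPE(real)" n .
  have fin: "finite (unit_vec n ` I :: real vec set)"
    using assms finite_subset by blast
  have carr: "unit_vec n ` I \<subseteq> (carrier_vec n :: real vec set)" by auto
  have inj: "inj_on (unit_vec n :: nat \<Rightarrow> real vec) I"
    using inj_on_unit_vec assms inj_on_subset by blast
  show ?thesis
  proof
    have "unit_vec n ` I \<subseteq> coord_subspace n I"
      using assms by (auto simp: unit_vec_in_coord_subspace)
    then show "span (unit_vec n ` I) \<subseteq> coord_subspace n I"
      using span_is_subset submodule_coord_subspace by blast
  next
    show "coord_subspace n I \<subseteq> span (unit_vec n ` I)"
    proof
      fix v assume v: "v \<in> coord_subspace n I"
      \<comment> \<open>\<open>lincomb\<close> expects coefficients indexed by vectors, so the index
        is recovered from the unit vector; this is legitimate because distinct indices give distinct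
        unit vectors.\<close>
      define a where "a u = v $ (the_inv_into I (unit_vec n) u)" for u :: "real vec"
      have a: "a (unit_vec n k) = v $ k" if "k \<in> I" for k
        using that inj by (simp add: a_def the_inv_into_f_f)
      have "v = lincomb a (unit_vec n ` I)"
      proof (rule eq_vecI)
        show "dim_vec v = dim_vec (lincomb a (unit_vec n ` I))"
          using v lincomb_dim[OF fin carr] by (simp add: coord_subspace_def)
        fix i assume "i < dim_vec (lincomb a (unit_vec n ` I))"
        then have i: "i < n" using lincomb_dim[OF fin carr] by simp
        have "lincomb a (unit_vec n ` I) $ i = (\<Sum>k\<in>I. a (unit_vec n k) * unit_vec n k $ i)"
          using i by (simp add: lincomb_index[OF i carr] sum.reindex[OF inj])
        also have "\<dots> = (\<Sum>k\<in>I. if k = i then v $ i else 0)"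
          using assms i by (intro sum.cong) (auto simp: a)
        also have "\<dots> = v $ i"
          using assms i v finite_subset[OF assms] by (auto simp: coord_subspace_def)
        finally show "v $ i = lincomb a (unit_vec n ` I) $ i" by simp
      qed
      then show "v \<in> span (unit_vec n ` I)" using fin by blast
    qed
  qed
qed

lemma standard_subspace_iff:
  "standard_subspace n L \<longleftrightarrow> (\<exists>I \<subseteq> {..<n}. L = coord_subspace n I)"
  unfolding standard_subspace_def using span_unit_vecs_eq_coord_subspace by metis

lemma vectorspace_coord_subspace:
  "vectorspace class_ring (subspace_vs n (coord_subspace n I))"
proof -
  interpret vec_space "TYPE(real)" n .
  show ?thesis
    using submodule_coord_subspace subspace_is_vs vectorspace_axioms
    by (simp add: VectorSpace.subspace_def)
qed

text \<open>The spanning unit vectors are part of the standard basis, hence independent, hence a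
  maximal independent subset of themselves. \<open>dim_span\<close> then reduces the dimension to
  counting them.\<close>

lemma dim_coord_subspace:
  assumes "I \<subseteq> {..<n}"
  shows "vectorspace.dim class_ring (subspace_vs n (coord_subspace n I)) = card I"
proof -
  interpret vec_space "TYPE(real)" n .
  have fin: "finite (unit_vec n ` I :: real vec set)"
    using assms finite_subset by blast
  have sub: "unit_vec n ` I \<subseteq> (set (unit_vecs n) :: real vec set)"
    using assms by (auto simp: unit_vecs_def)
  have carr: "unit_vec n ` I \<subseteq> (carrier_vec n :: real vec set)" by auto
  have "lin_indpt (unit_vec n ` I)"
    using unit_vecs_basis sub subset_li_is_li unfolding basis_def by blast
  then have "maximal (unit_vec n ` I) (\<lambda>T. T \<subseteq> unit_vec n ` I \<and> lin_indpt T)"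
    by (auto simp: maximal_def)
  from dim_span[OF carr fin this] have "vectorspace.dim class_ring (span_vs (unit_vec n ` I)) = card (unit_vec n ` I :: real vec set)" .
  also have "\<dots> = card I"
    by (rule card_image[OF inj_on_subset[OF inj_on_unit_vec assms]])
  finally show ?thesis
    by (simp add: span_unit_vecs_eq_coord_subspace[OF assms])
qed

section \<open>Decompositions into standard subspaces as partitions of the index set\<close>

definition index_partition :: "nat \<Rightarrow> nat set \<Rightarrow> nat set \<Rightarrow> nat set \<Rightarrow> bool" where
  "index_partition n I J K \<longleftrightarrow>
     I \<inter> J = {} \<and> I \<inter> K = {} \<and> J \<inter> K = {} \<and> I \<union> J \<union> K = {..<n}"

text \<open>A shared index contradicts injectivity, since its unit vector could be placed in either
  summand; a missing index contradicts surjectivity, since every sum vanishes there. Conversely, a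
  partition makes the components of a vector its restrictions to the three blocks.\<close>

lemma bij_betw_coord_subspaces_iff:
  assumes "I \<subseteq> {..<n}" "J \<subseteq> {..<n}" "K \<subseteq> {..<n}"
  shows "bij_betw (\<lambda>(u, v, w). u + v + w)
      (coord_subspace n I \<times> coord_subspace n J \<times> coord_subspace n K) (carrier_vec n)
    \<longleftrightarrow> index_partition n I J K"
    (is "bij_betw ?f ?D ?C \<longleftrightarrow> _")
proof
  assume bij: "bij_betw ?f ?D ?C"
  then have inj: "inj_on ?f ?D" and surj: "?f ` ?D = ?C" by (auto simp: bij_betw_def)
  have unit_ne: "unit_vec n i \<noteq> (0\<^sub>v n :: real vec)" if "i < n" for i
    using that by simp
  have "i \<notin> J" if "i \<in> I" for i
  proof
    assume "i \<in> J"
    have "i < n" using that assms by auto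
    then show False
      using inj_onD[OF inj, of "(unit_vec n i, 0\<^sub>v n, 0\<^sub>v n)" "(0\<^sub>v n, unit_vec n i, 0\<^sub>v n)"]
        that \<open>i \<in> J\<close> unit_ne by (simp add: unit_vec_in_coord_subspace)
  qed
  moreover have "i \<notin> K" if "i \<in> I" for i
  proof
    assume "i \<in> K"
    have "i < n" using that assms by auto
    then show False
      using inj_onD[OF inj, of "(unit_vec n i, 0\<^sub>v n, 0\<^sub>v n)" "(0\<^sub>v n, 0\<^sub>v n, unit_vec n i)"]
        that \<open>i \<in> K\<close> unit_ne by (simp add: unit_vec_in_coord_subspace)
  qed
  moreover have "i \<notin> K" if "i \<in> J" for i
  proof
    assume "i \<in> K"
    have "i < n" using that assms by auto
    then show False
      using inj_onD[OF inj, of "(0\<^sub>v n, unit_vec n i, 0\<^sub>v n)" "(0\<^sub>v n, 0\<^sub>v n, unit_vec n i)"]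
        that \<open>i \<in> K\<close> unit_ne by (simp add: unit_vec_in_coord_subspace)
  qed
  moreover have "i \<in> I \<union> J \<union> K" if "i < n" for i
  proof (rule ccontr)
    assume i: "i \<notin> I \<union> J \<union> K"
    have "unit_vec n i \<in> ?f ` ?D" using surj by simp
    then obtain u v w where uvw: "u \<in> coord_subspace n I" "v \<in> coord_subspace n J"
      "w \<in> coord_subspace n K" "unit_vec n i = u + v + w" by auto
    have "unit_vec n i $ i = u $ i + v $ i + w $ i"
    proof -
      have "i < dim_vec u" "i < dim_vec v" "i < dim_vec w"
        using uvw(1-3) that by (auto simp: coord_subspace_def)
      then show ?thesis by (simp add: uvw(4))
    qed
    moreover have "u $ i = 0" "v $ i = 0" "w $ i = 0"
      using uvw(1-3) i that by (auto simp: coord_subspace_def)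
    ultimately show False using that by simp
  qed
  ultimately show "index_partition n I J K"
    using assms by (auto simp: index_partition_def)
next
  assume part: "index_partition n I J K"
  have "inj_on ?f ?D"
  proof (rule inj_onI, clarify)
    fix u v w u' v' w'
    assume mem: "u \<in> coord_subspace n I" "v \<in> coord_subspace n J" "w \<in> coord_subspace n K"
      "u' \<in> coord_subspace n I" "v' \<in> coord_subspace n J" "w' \<in> coord_subspace n K"
      and eq: "u + v + w = u' + v' + w'"
    have comp: "u $ i = u' $ i \<and> v $ i = v' $ i \<and> w $ i = w' $ i" if "i < n" for i
    proof -
      have "(u + v + w) $ i = (u' + v' + w') $ i" using eq by simp
      then have "u $ i + v $ i + w $ i = u' $ i + v' $ i + w' $ i"
        using mem that by (auto simp: coord_subspace_def)
      \<comment> \<open>The index \<open>i\<close> belongs to one block only, so two of the three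
        terms on each side are zero and the equation identifies the remaining ones.\<close>
      moreover have "(i \<notin> J \<and> i \<notin> K) \<or> (i \<notin> I \<and> i \<notin> K) \<or> (i \<notin> I \<and> i \<notin> J)"
        using part by (auto simp: index_partition_def)
      ultimately show ?thesis
        using mem that by (auto simp: coord_subspace_def)
    qed
    have "u = u'" "v = v'" "w = w'"
      using mem comp by (auto simp: coord_subspace_def)
    then show "u = u' \<and> (v, w) = (v', w')" by simp
  qed
  moreover have "?f ` ?D = ?C"
  proof (intro equalityI subsetI)
    fix x assume "x \<in> ?f ` ?D"
    then show "x \<in> ?C" by (auto simp: coord_subspace_def)
  next
    fix x :: "real vec" assume x: "x \<in> ?C"
    define r where "r S = vec n (\<lambda>i. if i \<in> S then x $ i else 0)" for S :: "nat set"
    have "r S \<in> coord_subspace n S" for S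
      by (auto simp: r_def coord_subspace_def)
    moreover have "x = r I + r J + r K"
    proof (rule eq_vecI)
      fix i assume "i < dim_vec (r I + r J + r K)"
      then have i: "i < n" by (simp add: r_def)
      then have "(i \<in> I \<and> i \<notin> J \<and> i \<notin> K) \<or> (i \<notin> I \<and> i \<in> J \<and> i \<notin> K) \<or> (i \<notin> I \<and> i \<notin> J \<and> i \<in> K)"
        using part by (auto simp: index_partition_def)
      then show "x $ i = (r I + r J + r K) $ i"
        using i by (auto simp: r_def)
    qed (use x in \<open>simp add: r_def\<close>)
    ultimately have "(r I, r J, r K) \<in> ?D" "x = ?f (r I, r J, r K)" by auto
    then show "x \<in> ?f ` ?D" by blast
  qed
  ultimately show "bij_betw ?f ?D ?C" by (simp add: bij_betw_def)
qed

lemma standard_decomposition_iff: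
  "standard_decomposition n L1 L2 L3 \<longleftrightarrow>
    (\<exists>I J K. index_partition n I J K \<and>
      L1 = coord_subspace n I \<and> L2 = coord_subspace n J \<and> L3 = coord_subspace n K)"
proof
  assume L: "standard_decomposition n L1 L2 L3"
  then obtain I J K where sub: "I \<subseteq> {..<n}" "J \<subseteq> {..<n}" "K \<subseteq> {..<n}"
    and eq: "L1 = coord_subspace n I" "L2 = coord_subspace n J" "L3 = coord_subspace n K"
    unfolding standard_decomposition_def standard_subspace_iff by blast
  then show "\<exists>I J K. index_partition n I J K \<and>
      L1 = coord_subspace n I \<and> L2 = coord_subspace n J \<and> L3 = coord_subspace n K"
    using L bij_betw_coord_subspaces_iff[OF sub] unfolding standard_decomposition_def by blast
next
  assume "\<exists>I J K. index_partition n I J K \<and>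
      L1 = coord_subspace n I \<and> L2 = coord_subspace n J \<and> L3 = coord_subspace n K"
  then obtain I J K where part: "index_partition n I J K"
    and eq: "L1 = coord_subspace n I" "L2 = coord_subspace n J" "L3 = coord_subspace n K"
    by blast
  then have sub: "I \<subseteq> {..<n}" "J \<subseteq> {..<n}" "K \<subseteq> {..<n}"
    by (auto simp: index_partition_def)
  then show "standard_decomposition n L1 L2 L3"
    using part bij_betw_coord_subspaces_iff[OF sub] eq
    unfolding standard_decomposition_def standard_subspace_iff by blast
qed

section \<open>Nonnegative rank\<close>

text \<open>The minimum is attained because \<open>1 * A\<close> is one admissible factorization. An
  optimal factorization extends to any larger inner dimension \<open>k\<close> by zero columns on
  the left factor and zero rows on the right factor.\<close>

lemma nonneg_rank_le_iff:
  assumes "nonneg_mat A"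
  shows "nonneg_rank A \<le> k \<longleftrightarrow>
    (\<exists>L R. L \<in> carrier_mat (dim_row A) k \<and> R \<in> carrier_mat k (dim_col A) \<and>
      nonneg_mat L \<and> nonneg_mat R \<and> A = L * R)"
    (is "_ \<longleftrightarrow> ?fac k")
proof
  assume le: "nonneg_rank A \<le> k"
  have "?fac (dim_row A)"
    using assms by - (rule exI[of _ "1\<^sub>m (dim_row A)"], rule exI[of _ A], auto simp: nonneg_mat_def)
  then have "?fac (nonneg_rank A)"
    unfolding nonneg_rank_def by (rule LeastI)
  then obtain L R where LR: "L \<in> carrier_mat (dim_row A) (nonneg_rank A)"
    "R \<in> carrier_mat (nonneg_rank A) (dim_col A)" "nonneg_mat L" "nonneg_mat R" "A = L * R"
    by blast
  define L' where "L' = mat (dim_row A) k (\<lambda>(i, j). if j < nonneg_rank A then L $$ (i, j) else 0)"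
  define R' where "R' = mat k (dim_col A) (\<lambda>(i, j). if i < nonneg_rank A then R $$ (i, j) else 0)"
  have "A = L' * R'"
  proof (rule eq_matI)
    fix i j assume "i < dim_row (L' * R')" "j < dim_col (L' * R')"
    then have ij: "i < dim_row A" "j < dim_col A" by (simp_all add: L'_def R'_def)
    have "A $$ (i, j) = (L * R) $$ (i, j)" using LR(5) by simp
    also have "\<dots> = (\<Sum>l<nonneg_rank A. L $$ (i, l) * R $$ (l, j))"
      using LR(1,2) ij by (simp add: scalar_prod_def lessThan_atLeast0)
    also have "\<dots> = (\<Sum>l<k. L' $$ (i, l) * R' $$ (l, j))"
      using le ij by (intro sum.mono_neutral_cong_left) (auto simp: L'_def R'_def)
    also have "\<dots> = (L' * R') $$ (i, j)"
      using ij by (simp add: L'_def R'_def scalar_prod_def lessThan_atLeast0)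
    finally show "A $$ (i, j) = (L' * R') $$ (i, j)" .
  qed (simp_all add: L'_def R'_def)
  moreover have "nonneg_mat L'" "nonneg_mat R'"
    using LR(1-4) by (auto simp: L'_def R'_def nonneg_mat_def)
  ultimately show "?fac k"
    by - (rule exI[of _ L'], rule exI[of _ R'], auto simp: L'_def R'_def)
next
  assume "?fac k"
  then show "nonneg_rank A \<le> k"
    unfolding nonneg_rank_def by (rule Least_le)
qed

section \<open>Nonnegative rank of a submatrix in terms of the original indices\<close>

lemma bij_betw_pick:
  assumes "finite I"
  shows "bij_betw (pick I) {..<card I} I"
proof -
  have "inj_on (pick I) {..<card I}"
  proof (rule linorder_inj_onI)
    show "pick I k \<noteq> pick I l" if "k < l" "k \<in> {..<card I}" "l \<in> {..<card I}" for k l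
      using pick_mono_le[of l I k] that by simp
  qed auto
  moreover have "pick I ` {..<card I} \<subseteq> I"
    by (auto intro: pick_in_set_le)
  ultimately show ?thesis
    using assms by (simp add: bij_betw_def card_image card_subset_eq)
qed

text \<open>Transporting all three index ranges along \<open>pick\<close> turns a factorization with
  inner dimension \<open>card J\<close> into one whose inner sum runs over \<open>J\<close> itself,
  so that later arguments work with indices of \<real>^n only.\<close>

lemma nonneg_rank_submatrix_le_iff:
  fixes a :: "nat \<Rightarrow> nat \<Rightarrow> real" and J :: "nat set"
  assumes "finite I" "finite J" "finite K" and nonneg: "\<And>i k. i \<in> I \<Longrightarrow> k \<in> K \<Longrightarrow> 0 \<le> a i k"
  shows "nonneg_rank (mat (card I) (card K) (\<lambda>(i, k). a (pick I i) (pick K k))) \<le> card J \<longleftrightarrow>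
    (\<exists>x y. (\<forall>i j. 0 \<le> x i j) \<and> (\<forall>j k. 0 \<le> y j k) \<and>
      (\<forall>i\<in>I. \<forall>k\<in>K. a i k = (\<Sum>j\<in>J. x i j * y j k)))"
    (is "nonneg_rank ?A \<le> _ \<longleftrightarrow> ?R")
proof
  have pick: "\<exists>l<card S. i = pick S l" if "finite S" "i \<in> S" for S i
    using bij_betw_pick[OF that(1)] that(2) by (auto simp: bij_betw_def)
  have A: "nonneg_mat ?A"
    by (auto simp: nonneg_mat_def intro!: nonneg pick_in_set_le)
  {
    assume "nonneg_rank ?A \<le> card J"
    then obtain X Y where X: "X \<in> carrier_mat (card I) (card J)" "nonneg_mat X"
      and Y: "Y \<in> carrier_mat (card J) (card K)" "nonneg_mat Y" and eq: "?A = X * Y"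
      unfolding nonneg_rank_le_iff[OF A] by auto
    \<comment> \<open>Counting the smaller elements of \<open>S\<close> inverts the increasing
      enumeration \<open>pick S\<close>.\<close>
    define pos where "pos S i = card {l \<in> S. l < i}" for S :: "nat set" and i
    have pos: "pos S (pick S l) = l" if "l < card S" for S l
      using that by (simp add: pos_def card_pick_le)
    \<comment> \<open>The absolute values make \<open>x\<close> and \<open>y\<close> nonnegative on
      all arguments, including those that lead outside the matrices. On the entries that enter the
      sum they change nothing.\<close>
    define x where "x i j = \<bar>X $$ (pos I i, pos J j)\<bar>" for i j
    define y where "y j k = \<bar>Y $$ (pos J j, pos K k)\<bar>" for j k
    have "a i k = (\<Sum>j\<in>J. x i j * y j k)" if i: "i \<in> I" and k: "k \<in> K" for i k
    proof -
      obtain p q where p: "p < card I" "i = pick I p" and q: "q < card K" "k = pick K q"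
        using pick[OF \<open>finite I\<close> i] pick[OF \<open>finite K\<close> k] by blast
      have "a i k = ?A $$ (p, q)" using p q by simp
      also have "\<dots> = (\<Sum>l<card J. X $$ (p, l) * Y $$ (l, q))"
        unfolding eq using X(1) Y(1) p q by (simp add: scalar_prod_def lessThan_atLeast0)
      also have "\<dots> = (\<Sum>l<card J. x i (pick J l) * y (pick J l) k)"
        using X Y p q by (intro sum.cong) (auto simp: x_def y_def pos nonneg_mat_def)
      also have "\<dots> = (\<Sum>j\<in>J. x i j * y j k)"
        by (rule sum.reindex_bij_betw[OF bij_betw_pick[OF \<open>finite J\<close>]])
      finally show ?thesis .
    qed
    then show ?R by - (rule exI[of _ x], rule exI[of _ y], simp add: x_def y_def)
  }
  assume ?R
  then obtain x y where xy: "\<And>i j. 0 \<le> x i j" "\<And>j k. 0 \<le> y j k"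
    "\<And>i k. i \<in> I \<Longrightarrow> k \<in> K \<Longrightarrow> a i k = (\<Sum>j\<in>J. x i j * y j k)" by blast
  define X where "X = mat (card I) (card J) (\<lambda>(i, j). x (pick I i) (pick J j))"
  define Y where "Y = mat (card J) (card K) (\<lambda>(j, k). y (pick J j) (pick K k))"
  have "?A = X * Y"
  proof (rule eq_matI)
    fix p q assume "p < dim_row (X * Y)" "q < dim_col (X * Y)"
    then have pq: "p < card I" "q < card K" by (simp_all add: X_def Y_def)
    then have "?A $$ (p, q) = (\<Sum>j\<in>J. x (pick I p) j * y j (pick K q))"
      by (simp add: xy(3) pick_in_set_le)
    also have "\<dots> = (\<Sum>l<card J. x (pick I p) (pick J l) * y (pick J l) (pick K q))"
      by (rule sum.reindex_bij_betw[OF bij_betw_pick[OF \<open>finite J\<close>], symmetric])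
    also have "\<dots> = (X * Y) $$ (p, q)"
      using pq by (simp add: X_def Y_def scalar_prod_def lessThan_atLeast0)
    finally show "?A $$ (p, q) = (X * Y) $$ (p, q)" .
  qed (simp_all add: X_def Y_def)
  then show "nonneg_rank ?A \<le> card J"
    unfolding nonneg_rank_le_iff[OF A] using xy
    by - (rule exI[of _ X], rule exI[of _ Y], auto simp: X_def Y_def nonneg_mat_def)
qed

section \<open>The combinatorial condition\<close>

definition corner_supported :: "nat \<Rightarrow> nat set \<Rightarrow> nat set \<Rightarrow> real mat \<Rightarrow> bool" where
  "corner_supported n I K T \<longleftrightarrow> (\<forall>i<n. \<forall>k<n. \<not> (i \<in> I \<and> k \<in> K) \<longrightarrow> T $$ (i, k) = 0)"

text \<open>For a nonnegative block on finite \<open>I\<close> and \<open>K\<close>, with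
  \<open>J\<close> finite, this says that its nonnegative rank is at most \<open>card J\<close>.
  Using \<open>J\<close> itself as the inner index set allows its elements to serve as rows and
  columns of n x n matrices.\<close>

definition nonneg_factors_through ::
  "nat set \<Rightarrow> nat set \<Rightarrow> nat set \<Rightarrow> real mat \<Rightarrow> bool" where
  "nonneg_factors_through I J K T \<longleftrightarrow>
    (\<exists>x y. (\<forall>i j. 0 \<le> x i j) \<and> (\<forall>j k. 0 \<le> y j k) \<and>
      (\<forall>i\<in>I. \<forall>k\<in>K. T $$ (i, k) = (\<Sum>j\<in>J. x i j * y j k)))"

lemma index_mult_mat_sum:
  assumes "A \<in> carrier_mat m l" "B \<in> carrier_mat l n" "i < m" "j < n"
  shows "(A * B) $$ (i, j) = (\<Sum>k<l. A $$ (i, k) * B $$ (k, j))"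
  using assms by (simp add: scalar_prod_def lessThan_atLeast0)

lemma mult_mat_eq_zeroI:
  assumes "A \<in> carrier_mat m l" "B \<in> carrier_mat l n"
    and "\<And>i k j. i < m \<Longrightarrow> k < l \<Longrightarrow> j < n \<Longrightarrow> A $$ (i, k) * B $$ (k, j) = 0"
  shows "A * B = 0\<^sub>m m n"
proof (rule eq_matI)
  fix i j assume "i < dim_row (0\<^sub>m m n :: 'a mat)" "j < dim_col (0\<^sub>m m n :: 'a mat)"
  then show "(A * B) $$ (i, j) = 0\<^sub>m m n $$ (i, j)"
    using assms(3) by (auto simp: index_mult_mat_sum[OF assms(1,2)] intro!: sum.neutral)
qed (use assms in auto)

lemma pow_mat_2: "A \<in> carrier_mat n n \<Longrightarrow> A ^\<^sub>m 2 = A * (A :: 'a :: semiring_1 mat)"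
  by (simp add: numeral_2_eq_2)

lemma pow_mat_3: "A \<in> carrier_mat n n \<Longrightarrow> A ^\<^sub>m 3 = A * A * (A :: 'a :: semiring_1 mat)"
  by (simp add: numeral_3_eq_3)

section \<open>Nilpotent factors, square roots and the combinatorial condition\<close>

lemma nilpotent_factors_of_corner:
  assumes T: "T \<in> carrier_mat n n" and part: "index_partition n I J K"
    and supp: "corner_supported n I K T" and fac: "nonneg_factors_through I J K T"
  shows "\<exists>M N. M \<in> carrier_mat n n \<and> N \<in> carrier_mat n n \<and> nonneg_mat M \<and> nonneg_mat N \<and>
        T = M * N \<and> M ^\<^sub>m 2 = 0\<^sub>m n n \<and> N ^\<^sub>m 2 = 0\<^sub>m n n \<and> N * M = 0\<^sub>m n n"
proof -
  obtain x y where xy: "\<And>i j. 0 \<le> x i j" "\<And>j k. 0 \<le> y j k"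
    and eq: "\<And>i k. i \<in> I \<Longrightarrow> k \<in> K \<Longrightarrow> T $$ (i, k) = (\<Sum>j\<in>J. x i j * y j k)"
    using fac unfolding nonneg_factors_through_def by blast
  define M where "M = mat n n (\<lambda>(i, j). if i \<in> I \<and> j \<in> J then x i j else 0)"
  define N where "N = mat n n (\<lambda>(j, k). if j \<in> J \<and> k \<in> K then y j k else 0)"
  have M: "M \<in> carrier_mat n n" and N: "N \<in> carrier_mat n n" by (simp_all add: M_def N_def)
  have "T = M * N"
  proof (rule eq_matI)
    fix i k assume "i < dim_row (M * N)" "k < dim_col (M * N)"
    then have ik: "i < n" "k < n" using M N by auto
    have "(M * N) $$ (i, k) = (\<Sum>j<n. M $$ (i, j) * N $$ (j, k))"
      using index_mult_mat_sum[OF M N] ik by blast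
    \<comment> \<open>Terms with \<open>j\<close> outside \<open>J\<close> vanish. The conditional
      keeps the formula valid outside the corner \<open>I\<close> x \<open>K\<close>, where both
      sides must be zero.\<close>
    also have "\<dots> = (\<Sum>j\<in>J. if i \<in> I \<and> k \<in> K then x i j * y j k else 0)"
      using ik part
      by (intro sum.mono_neutral_cong_right) (auto simp: M_def N_def index_partition_def)
    also have "\<dots> = T $$ (i, k)"
      using supp ik by (cases "i \<in> I \<and> k \<in> K") (auto simp: eq corner_supported_def)
    finally show "T $$ (i, k) = (M * N) $$ (i, k)" by simp
  qed (use T M N in auto)
  \<comment> \<open>A nonzero term would have its inner index in both \<open>J\<close> and
    \<open>I\<close> for \<open>M * M\<close>, in both \<open>K\<close> and \<open>J\<close> for
    \<open>N * N\<close>, and in both \<open>K\<close> and \<open>I\<close> for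
    \<open>N * M\<close>.\<close>
  moreover have "M * M = 0\<^sub>m n n" "N * N = 0\<^sub>m n n" "N * M = 0\<^sub>m n n"
    using part by (auto intro!: mult_mat_eq_zeroI simp: M_def N_def index_partition_def)
  moreover have "nonneg_mat M" "nonneg_mat N"
    using xy by (auto simp: nonneg_mat_def M_def N_def)
  ultimately show ?thesis using M N pow_mat_2 by metis
qed

text \<open>Of the four products in the square of \<open>M + N\<close> only \<open>M * N\<close>
  survives. Multiplying once more by \<open>M + N\<close> gives
  \<open>M * (N * M) + M * (N * N)\<close>, and both terms vanish.\<close>

lemma square_root_of_nilpotent_factors:
  assumes M: "M \<in> carrier_mat n n" "nonneg_mat M" "M ^\<^sub>m 2 = 0\<^sub>m n n"
    and N: "N \<in> carrier_mat n n" "nonneg_mat N" "N ^\<^sub>m 2 = 0\<^sub>m n n"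
    and NM: "N * M = 0\<^sub>m n n"
  shows "\<exists>U. U \<in> carrier_mat n n \<and> nonneg_mat U \<and> M * N = U ^\<^sub>m 2 \<and> U ^\<^sub>m 3 = 0\<^sub>m n n"
proof (intro exI conjI)
  let ?U = "M + N"
  show U: "?U \<in> carrier_mat n n" using M N by simp
  show "nonneg_mat ?U" using M N by (auto simp: nonneg_mat_def)
  have MM: "M * M = 0\<^sub>m n n" and NN: "N * N = 0\<^sub>m n n"
    using M N pow_mat_2 by metis+
  have sq: "?U * ?U = M * N"
  proof -
    have "?U * ?U = (M * M + N * M) + (M * N + N * N)"
      using M(1) N(1) U by (simp add: mult_add_distrib_mat[OF U] add_mult_distrib_mat)
    then show ?thesis using M(1) N(1) by (simp add: MM NN NM)
  qed
  then show "M * N = ?U ^\<^sub>m 2" using pow_mat_2[OF U] by simp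
  have "M * N * ?U = M * (N * M) + M * (N * N)"
    using M(1) N(1) U by (simp add: mult_add_distrib_mat[of _ n n _ n])
  also have "\<dots> = 0\<^sub>m n n"
    using M(1) by (simp add: NM NN)
  finally show "?U ^\<^sub>m 3 = 0\<^sub>m n n" using pow_mat_3[OF U] sq by simp
qed

lemma corner_of_square_root:
  assumes U: "U \<in> carrier_mat n n" "nonneg_mat U" and cube: "U ^\<^sub>m 3 = 0\<^sub>m n n"
  shows "\<exists>I J K. index_partition n I J K \<and> corner_supported n I K (U ^\<^sub>m 2) \<and>
    nonneg_factors_through I J K (U ^\<^sub>m 2)"
proof -
  define E where "E i j \<longleftrightarrow> i < n \<and> j < n \<and> U $$ (i, j) \<noteq> 0" for i j
  have nn: "0 \<le> U $$ (i, j)" if "i < n" "j < n" for i j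
    using U that by (auto simp: nonneg_mat_def)
  have UU: "U * U \<in> carrier_mat n n" using U by simp
  have sq: "(U ^\<^sub>m 2) $$ (i, k) = (\<Sum>j<n. U $$ (i, j) * U $$ (j, k))" if "i < n" "k < n" for i k
    using index_mult_mat_sum[OF U(1) U(1) that] pow_mat_2[OF U(1)] by simp
  \<comment> \<open>This is the absence of cancellation: a single term bounds the sum of nonnegative
    terms from below.\<close>
  have sq_ge: "U $$ (i, j) * U $$ (j, k) \<le> (U ^\<^sub>m 2) $$ (i, k)" if "i < n" "j < n" "k < n" for i j k
    unfolding sq[OF that(1,3)] using that nn
    by (intro member_le_sum[of j "{..<n}" "\<lambda>j. U $$ (i, j) * U $$ (j, k)"]) auto
  \<comment> \<open>The product of the three weights along such a walk is positive and bounds the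
    \<open>(i, l)\<close> entry of the cube from below, contradicting \<open>cube\<close>.\<close>
  have no_walk: False if "E i j" "E j k" "E k l" for i j k l
  proof -
    have bd: "i < n" "j < n" "k < n" "l < n" using that by (auto simp: E_def)
    have pos: "0 < U $$ (i, j)" "0 < U $$ (j, k)" "0 < U $$ (k, l)"
      using that nn by (auto simp: E_def less_le)
    have "0 < (U $$ (i, j) * U $$ (j, k)) * U $$ (k, l)" using pos by simp
    also have "\<dots> \<le> (U ^\<^sub>m 2) $$ (i, k) * U $$ (k, l)"
      using sq_ge bd nn by (intro mult_right_mono) auto
    also have "\<dots> \<le> (\<Sum>k<n. (U ^\<^sub>m 2) $$ (i, k) * U $$ (k, l))"
      using bd nn
      by (intro member_le_sum[of k "{..<n}" "\<lambda>k. (U ^\<^sub>m 2) $$ (i, k) * U $$ (k, l)"])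
        (auto simp: sq intro!: mult_nonneg_nonneg sum_nonneg)
    also have "\<dots> = (U ^\<^sub>m 3) $$ (i, l)"
      using index_mult_mat_sum[OF UU U(1)] bd pow_mat_3[OF U(1)] pow_mat_2[OF U(1)] by simp
    finally show False using cube bd by simp
  qed
  define I where "I = {i. \<exists>j k. E i j \<and> E j k}"
  define K where "K = {k. \<exists>i j. E i j \<and> E j k}"
  define J where "J = {..<n} - I - K"
  \<comment> \<open>At a common index, a walk of length two arriving there could be prolonged by an
    edge leaving it.\<close>
  have "I \<inter> K = {}" using no_walk by (auto simp: I_def K_def)
  moreover have "I \<subseteq> {..<n}" "K \<subseteq> {..<n}" by (auto simp: I_def K_def E_def)
  ultimately have "index_partition n I J K"
    by (auto simp: index_partition_def J_def)
  moreover have "corner_supported n I K (U ^\<^sub>m 2)"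
    unfolding corner_supported_def
  proof (intro allI impI)
    fix i k assume ik: "i < n" "k < n" "\<not> (i \<in> I \<and> k \<in> K)"
    \<comment> \<open>A nonzero product would be a walk of length two from \<open>i\<close> to
      \<open>k\<close>, putting \<open>i\<close> into \<open>I\<close> and \<open>k\<close> into
      \<open>K\<close>.\<close>
    then have "U $$ (i, j) * U $$ (j, k) = 0" if "j < n" for j
      using that unfolding I_def K_def E_def by fastforce
    then show "(U ^\<^sub>m 2) $$ (i, k) = 0"
      unfolding sq[OF ik(1,2)] by (intro sum.neutral) auto
  qed
  moreover have "nonneg_factors_through I J K (U ^\<^sub>m 2)"
    unfolding nonneg_factors_through_def
  proof (intro exI conjI allI ballI)
    let ?u = "\<lambda>i j. \<bar>U $$ (i, j)\<bar>"
    fix i k assume "i \<in> I" "k \<in> K"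
    then have ik: "i < n" "k < n" using \<open>I \<subseteq> {..<n}\<close> \<open>K \<subseteq> {..<n}\<close> by auto
    \<comment> \<open>If the middle vertex \<open>j\<close> were in \<open>I\<close>, the edge from
      \<open>i\<close> could be put before a walk of length two starting at \<open>j\<close>; if it
      were in \<open>K\<close>, the edge to \<open>k\<close> could be put after one ending at
      \<open>j\<close>.\<close>
    have "U $$ (i, j) * U $$ (j, k) = 0" if j: "j < n" "j \<notin> J" for j
    proof (rule ccontr)
      assume "U $$ (i, j) * U $$ (j, k) \<noteq> 0"
      then have "E i j" "E j k" using ik j by (auto simp: E_def)
      moreover have "j \<in> I \<or> j \<in> K" using j by (auto simp: J_def)
      ultimately show False using no_walk by (auto simp: I_def K_def)
    qed
    then show "(U ^\<^sub>m 2) $$ (i, k) = (\<Sum>j\<in>J. ?u i j * ?u j k)"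
      unfolding sq[OF ik] using ik nn
      by (intro sum.mono_neutral_cong_right) (auto simp: J_def)
  qed auto
  ultimately show ?thesis by blast
qed

section \<open>The operator block form in coordinates\<close>

lemma mult_mat_vec_unit_vec:
  fixes T :: "real mat"
  assumes "T \<in> carrier_mat n n" "i < n" "k < n"
  shows "(T *\<^sub>v unit_vec n k) $ i = T $$ (i, k)"
  using assms by simp

text \<open>Setting two of the three summands to zero isolates one block column. The third shows
  that \<open>f\<close> agrees with \<open>T\<close> and maps into the first subspace, which removes
  the rows outside \<open>I\<close>; the first two show that \<open>T\<close> sends the unit vectors
  of \<open>I\<close> and \<open>J\<close> to \<open>f 0 = 0\<close>.\<close>

lemma corner_block_form_coord_subspace:
  assumes T: "T \<in> carrier_mat n n" and part: "index_partition n I J K"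
    and form: "corner_block_form T (coord_subspace n I) (coord_subspace n J) (coord_subspace n K) f"
  shows "corner_supported n I K T"
    and "v \<in> coord_subspace n K \<Longrightarrow> f v = T *\<^sub>v v"
proof -
  have form': "f w \<in> coord_subspace n I" "T *\<^sub>v (u + v + w) = f w"
    if "u \<in> coord_subspace n I" "v \<in> coord_subspace n J" "w \<in> coord_subspace n K" for u v w
    using form that unfolding corner_block_form_def by auto
  show f: "f v = T *\<^sub>v v" if "v \<in> coord_subspace n K" for v
    using form'(2)[of "0\<^sub>v n" "0\<^sub>v n" v] that coord_subspace_carrier[OF that] by simp
  have f0: "f (0\<^sub>v n) = 0\<^sub>v n"
    using f[of "0\<^sub>v n"] T by (auto simp: scalar_prod_def)
  show "corner_supported n I K T"
    unfolding corner_supported_def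
  proof (intro allI impI)
    fix i k assume ik: "i < n" "k < n" "\<not> (i \<in> I \<and> k \<in> K)"
    let ?e = "unit_vec n k :: real vec"
    consider "k \<in> I" | "k \<in> J" | "k \<in> K" "i \<notin> I"
      using ik part by (auto simp: index_partition_def)
    then have "(T *\<^sub>v ?e) $ i = 0"
    proof cases
      case 1
      then show ?thesis
        using form'(2)[of ?e "0\<^sub>v n" "0\<^sub>v n"] ik f0 by (simp add: unit_vec_in_coord_subspace)
    next
      case 2
      then show ?thesis
        using form'(2)[of "0\<^sub>v n" ?e "0\<^sub>v n"] ik f0 by (simp add: unit_vec_in_coord_subspace)
    next
      case 3
      then have e: "?e \<in> coord_subspace n K" using ik by (simp add: unit_vec_in_coord_subspace)
      then have "T *\<^sub>v ?e \<in> coord_subspace n I"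
        using form'(1)[of "0\<^sub>v n" "0\<^sub>v n" ?e] f by simp
      then show ?thesis using 3 ik by (simp add: coord_subspace_def)
    qed
    then show "T $$ (i, k) = 0" using mult_mat_vec_unit_vec[OF T] ik by simp
  qed
qed

text \<open>Zero rows outside \<open>I\<close> put every image into the first subspace, and zero
  columns outside \<open>K\<close> make \<open>T\<close> vanish on the other two.\<close>

lemma corner_supported_mult_mat_vec:
  assumes T: "T \<in> carrier_mat n n" and part: "index_partition n I J K"
    and supp: "corner_supported n I K T"
  shows "v \<in> carrier_vec n \<Longrightarrow> T *\<^sub>v v \<in> coord_subspace n I"
    and "corner_block_form T (coord_subspace n I) (coord_subspace n J) (coord_subspace n K)
      (\<lambda>v. T *\<^sub>v v)"
proof -
  have ind: "(T *\<^sub>v v) $ i = (\<Sum>k<n. T $$ (i, k) * v $ k)" if "v \<in> carrier_vec n" "i < n" for v i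
    using T that by (simp add: scalar_prod_def lessThan_atLeast0)
  show im: "T *\<^sub>v v \<in> coord_subspace n I" if "v \<in> carrier_vec n" for v
    using that T supp by (auto simp: coord_subspace_def ind corner_supported_def simp del: index_mult_mat_vec)
  have ker: "T *\<^sub>v v = 0\<^sub>v n" if "v \<in> coord_subspace n S" "S \<inter> K = {}" for v S
  proof (rule eq_vecI)
    fix i assume "i < dim_vec (0\<^sub>v n :: real vec)"
    then have i: "i < n" by simp
    have "T $$ (i, k) * v $ k = 0" if "k < n" for k
      using that i \<open>v \<in> coord_subspace n S\<close> \<open>S \<inter> K = {}\<close> supp
      by (cases "k \<in> K") (auto simp: coord_subspace_def corner_supported_def)
    then show "(T *\<^sub>v v) $ i = 0\<^sub>v n $ i"
      unfolding ind[OF coord_subspace_carrier[OF that(1)] i] using i by (auto intro: sum.neutral)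
  qed (use T in simp)
  show "corner_block_form T (coord_subspace n I) (coord_subspace n J) (coord_subspace n K)
      (\<lambda>v. T *\<^sub>v v)"
    unfolding corner_block_form_def
  proof (intro ballI conjI)
    fix u v w
    assume u: "u \<in> coord_subspace n I" and v: "v \<in> coord_subspace n J" and w: "w \<in> coord_subspace n K"
    note c = u[THEN coord_subspace_carrier] v[THEN coord_subspace_carrier] w[THEN coord_subspace_carrier]
    show "T *\<^sub>v w \<in> coord_subspace n I" using im c by blast
    have "T *\<^sub>v u = 0\<^sub>v n" "T *\<^sub>v v = 0\<^sub>v n"
      using ker u v part by (auto simp: index_partition_def)
    then show "T *\<^sub>v (u + v + w) = T *\<^sub>v w"
      using T c by (simp add: mult_add_distrib_mat_vec[of T n n])
  qed
qed

text \<open>Multiplication by the whole matrix \<open>T\<close> can serve as \<open>T13\<close>,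
  because an operator is judged only by its values on its source.\<close>

lemma positive_operator_mult_mat_vec:
  assumes T: "T \<in> carrier_mat n n" "nonneg_mat T" and part: "index_partition n I J K"
    and supp: "corner_supported n I K T"
  shows "positive_operator n (coord_subspace n K) (coord_subspace n I) (\<lambda>v. T *\<^sub>v v)"
proof -
  let ?V = "subspace_vs n (coord_subspace n K)" and ?W = "subspace_vs n (coord_subspace n I)"
  have vs: "vectorspace class_ring ?V" "vectorspace class_ring ?W"
    by (rule vectorspace_coord_subspace)+
  have "(\<lambda>v. T *\<^sub>v v) \<in> LinearCombinations.module_hom class_ring ?V ?W"
    using corner_supported_mult_mat_vec(1)[OF T(1) part supp]
    by (simp add: LinearCombinations.module_hom_def module_vec_simps coord_subspace_carrier[of _ n K]
        mult_add_distrib_mat_vec[OF T(1)] mult_mat_vec[OF T(1)])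
  then have "linear_map class_ring ?V ?W (\<lambda>v. T *\<^sub>v v)"
    using vs unfolding linear_map_def mod_hom_def mod_hom_axioms_def vectorspace_def by blast
  moreover have "nonneg_vec (T *\<^sub>v v)" if "v \<in> coord_subspace n K" "nonneg_vec v" for v
    using that T coord_subspace_carrier[OF that(1)]
    by (auto simp: nonneg_vec_def nonneg_mat_def scalar_prod_def intro!: sum_nonneg)
  ultimately show ?thesis unfolding positive_operator_def by blast
qed

text \<open>Since \<open>f\<close> acts as \<open>T\<close> on the third subspace, its matrix is the
  submatrix of \<open>T\<close> with rows \<open>I\<close> and columns \<open>K\<close>, and the
  dimension on the right is \<open>card J\<close>.\<close>

lemma nonneg_rank_operator_matrix_le_iff:
  assumes T: "T \<in> carrier_mat n n" "nonneg_mat T" and part: "index_partition n I J K"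
    and f: "\<And>v. v \<in> coord_subspace n K \<Longrightarrow> f v = T *\<^sub>v v"
  shows "nonneg_rank (operator_matrix n (coord_subspace n K) (coord_subspace n I) f)
      \<le> vectorspace.dim class_ring (subspace_vs n (coord_subspace n J))
    \<longleftrightarrow> nonneg_factors_through I J K T"
proof -
  have sub: "I \<subseteq> {..<n}" "J \<subseteq> {..<n}" "K \<subseteq> {..<n}"
    using part by (auto simp: index_partition_def)
  then have fin: "finite I" "finite J" "finite K"
    using finite_subset by blast+
  have "operator_matrix n (coord_subspace n K) (coord_subspace n I) f
    = mat (card I) (card K) (\<lambda>(i, k). T $$ (pick I i, pick K k))"
  proof (rule eq_matI)
    fix p q
    assume "p < dim_row (mat (card I) (card K) (\<lambda>(i, k). T $$ (pick I i, pick K k)))"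
      and "q < dim_col (mat (card I) (card K) (\<lambda>(i, k). T $$ (pick I i, pick K k)))"
    then have pq: "p < card I" "q < card K" by auto
    then have "pick I p \<in> I" "pick K q \<in> K" by (simp_all add: pick_in_set_le)
    moreover from this have "pick I p < n" "pick K q < n" using sub by auto
    ultimately show "operator_matrix n (coord_subspace n K) (coord_subspace n I) f $$ (p, q)
      = mat (card I) (card K) (\<lambda>(i, k). T $$ (pick I i, pick K k)) $$ (p, q)"
      using pq mult_mat_vec_unit_vec[OF T(1)]
      by (simp add: operator_matrix_def unit_indices_coord_subspace sub f unit_vec_in_coord_subspace
          del: index_mult_mat_vec)
  qed (simp_all add: operator_matrix_def unit_indices_coord_subspace sub)
  moreover have "0 \<le> T $$ (i, k)" if "i \<in> I" "k \<in> K" for i k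
  proof -
    have "i < n" "k < n" using that sub by auto
    then show ?thesis using T by (simp add: nonneg_mat_def)
  qed
  ultimately show ?thesis
    using nonneg_rank_submatrix_le_iff[OF fin, of "\<lambda>i k. T $$ (i, k)"] dim_coord_subspace[OF sub(2)]
    unfolding nonneg_factors_through_def by simp
qed

theorem theorem2p1:
  fixes n :: nat and T :: "real mat"
  assumes "T \<in> carrier_mat n n" and "nonneg_mat T"
  defines "assertion_i \<equiv>
      \<exists>M N. M \<in> carrier_mat n n \<and> N \<in> carrier_mat n n \<and> nonneg_mat M \<and> nonneg_mat N \<and>
        T = M * N \<and> M ^\<^sub>m 2 = 0\<^sub>m n n \<and> N ^\<^sub>m 2 = 0\<^sub>m n n \<and> N * M = 0\<^sub>m n n"
    and "assertion_ii \<equiv>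
      \<exists>U. U \<in> carrier_mat n n \<and> nonneg_mat U \<and> T = U ^\<^sub>m 2 \<and> U ^\<^sub>m 3 = 0\<^sub>m n n"
    and "assertion_iii \<equiv>
      \<exists>L1 L2 L3 T13. standard_decomposition n L1 L2 L3 \<and>
        positive_operator n L3 L1 T13 \<and> corner_block_form T L1 L2 L3 T13 \<and>
        nonneg_rank (operator_matrix n L3 L1 T13) \<le> vectorspace.dim class_ring (subspace_vs n L2)"
  shows "(assertion_i \<longleftrightarrow> assertion_ii) \<and> (assertion_ii \<longleftrightarrow> assertion_iii)"
proof -
  \<comment> \<open>The first three implications form a cycle through \<open>corner\<close>, (i) and
    (ii); the last two attach (iii) to \<open>corner\<close>.\<close>
  define corner where "corner \<longleftrightarrow>
    (\<exists>I J K. index_partition n I J K \<and> corner_supported n I K T \<and> nonneg_factors_through I J K T)"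
  have "corner \<Longrightarrow> assertion_i"
    unfolding corner_def assertion_i_def using nilpotent_factors_of_corner[OF assms(1)] by blast
  moreover have "assertion_i \<Longrightarrow> assertion_ii"
    unfolding assertion_i_def assertion_ii_def using square_root_of_nilpotent_factors by blast
  moreover have "assertion_ii \<Longrightarrow> corner"
    unfolding assertion_ii_def corner_def using corner_of_square_root by blast
  moreover have "corner \<Longrightarrow> assertion_iii"
  proof -
    assume corner
    then obtain I J K where part: "index_partition n I J K" and supp: "corner_supported n I K T"
      and fac: "nonneg_factors_through I J K T" unfolding corner_def by blast
    have "standard_decomposition n (coord_subspace n I) (coord_subspace n J) (coord_subspace n K)"
      unfolding standard_decomposition_iff using part by blast
    then show assertion_iii
      unfolding assertion_iii_def
      using positive_operator_mult_mat_vec[OF assms(1,2) part supp]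
        corner_supported_mult_mat_vec(2)[OF assms(1) part supp]
        nonneg_rank_operator_matrix_le_iff[OF assms(1,2) part, of "\<lambda>v. T *\<^sub>v v"] fac by blast
  qed
  moreover have "assertion_iii \<Longrightarrow> corner"
  proof -
    assume assertion_iii
    then obtain I J K f where part: "index_partition n I J K"
      and form: "corner_block_form T (coord_subspace n I) (coord_subspace n J) (coord_subspace n K) f"
      and rank: "nonneg_rank (operator_matrix n (coord_subspace n K) (coord_subspace n I) f)
        \<le> vectorspace.dim class_ring (subspace_vs n (coord_subspace n J))"
      unfolding assertion_iii_def standard_decomposition_iff by blast
    then show corner
      unfolding corner_def
      using corner_block_form_coord_subspace[OF assms(1) part form]
        nonneg_rank_operator_matrix_le_iff[OF assms(1,2) part, of f] by blast
  qed
  ultimately show ?thesis by blast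
qed

end
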